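(* Let $q=2^k$ with $k\ge1$, let $n=4m$ with $m\ge1$, and let $t,s\in\mathrm{GF}(q)$. Then \[ F(n,t,s)=\begin{cases} q^{n-2}-(-1)^{mk}v(s)q^{2m-1}, & t=0,\\ q^{n-2}, & t\neq0.\end{cases} \]
   Context: For $\beta\in\mathrm{GF}(q^n)$, $Tr(\beta)=\sum_{i=0}^{n-1}\beta^{q^i}$ and $St(\beta)=\sum_{0\le i<j<n}\beta^{q^i}\beta^{q^j}$. $F(n,t,s)$ is the number of $\beta\in\mathrm{GF}(q^n)$ with $Tr(\beta)=t$ and $St(\beta)=s$. For $s\in\mathrm{GF}(q)$, $v(s)=q-1$ if $s=0$ and $v(s)=-1$ if $s\neq0$. *)

theory Defs
  imports "HOL-Library.Cardinality" "HOL-Computational_Algebra.Primes"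
begin

(* The ambient field GF(q^n) is a type of class finite_field whose cardinality is q^n,
   and GF(q) is a subfield of it with q elements. The degree n and the base order q are
   explicit arguments below, as they cannot be recovered from the ambient type. *)

definition is_subfield :: "'a::field set \<Rightarrow> bool" where
  "is_subfield K \<longleftrightarrow>
     0 \<in> K \<and> 1 \<in> K \<and>
     (\<forall>x\<in>K. \<forall>y\<in>K. x + y \<in> K \<and> x * y \<in> K) \<and>
     (\<forall>x\<in>K. - x \<in> K \<and> inverse x \<in> K)"

definition Tr :: "nat \<Rightarrow> nat \<Rightarrow> 'a::finite_field \<Rightarrow> 'a" where
  "Tr q n \<beta> = (\<Sum>i<n. \<beta> ^ (q ^ i))"

definition St :: "nat \<Rightarrow> nat \<Rightarrow> 'a::finite_field \<Rightarrow> 'a" where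
  "St q n \<beta> = (\<Sum>(i, j) \<in> {(i, j). i < j \<and> j < n}. \<beta> ^ (q ^ i) * \<beta> ^ (q ^ j))"

definition count_Tr_St :: "nat \<Rightarrow> nat \<Rightarrow> 'a::finite_field \<Rightarrow> 'a \<Rightarrow> nat" where
  "count_Tr_St q n t s = card {\<beta>::'a. Tr q n \<beta> = t \<and> St q n \<beta> = s}"

definition v :: "nat \<Rightarrow> 'a::finite_field \<Rightarrow> int" where
  "v q s = (if s = 0 then int q - 1 else - 1)"

(* The index set in St is finite, so its sum is not the default value 0. *)
lemma finite_St_index: "finite {(i, j). i < j \<and> j < (n::nat)}"
  by (rule finite_subset[of _ "{..<n} \<times> {..<n}"]) auto

end

theory Submission
  imports Defs "HOL-Computational_Algebra.Polynomial"
begin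

text \<open>
  In characteristic 2 the quadratic form \<open>St\<close> has polar form \<open>Tr x * Tr y + Tr (x * y)\<close>. For
  \<open>t \<noteq> 0\<close> the translations by \<open>GF(q)\<close> preserve \<open>Tr\<close> (as \<open>n\<close> is even) and permute the values
  of \<open>St\<close> transitively, so all values are equally frequent. For \<open>t = 0\<close> let \<open>Q = q ^ (2 * m)\<close>
  and \<open>L = GF(Q)\<close>; on \<open>L\<close> the form is the square of the trace from \<open>L\<close> to \<open>GF(q)\<close>, so the
  trace-zero part \<open>L0\<close> of \<open>L\<close> is totally singular, with orthogonal complement
  \<open>W = {x. x + x ^ Q \<in> GF(q)}\<close>. Off \<open>W\<close> the form is equidistributed along the cosets of
  \<open>L0\<close>, and its zeros on \<open>W\<close> are counted directly. The nonzero values are equally frequent because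
  every element of \<open>GF(q)\<close> is a square. Sizes of trace fibres come from a pigeonhole argument:
  each has at most \<open>q ^ (d - 1)\<close> elements as the root set of a polynomial of that degree, there
  are at most \<open>q\<close> of them, and together they have \<open>q ^ d\<close> elements.
\<close>

section \<open>Pigeonhole count of fibres\<close>

text \<open>Bounds on the number and the size of fibres whose product is \<open>card A\<close> must
  both be attained: one smaller fibre would make the total too small.\<close>

lemma card_fibres_eq:
  assumes "finite A" "finite B" "f ` A \<subseteq> B"
    and fibre: "\<And>y. y \<in> B \<Longrightarrow> card {x \<in> A. f x = y} \<le> c"
    and "card B \<le> b" "card A = b * c" "c > 0"
  shows "card B = b" and "y \<in> B \<Longrightarrow> card {x \<in> A. f x = y} = c"
proof -
  have A: "card A = (\<Sum>y\<in>B. card {x \<in> A. f x = y})"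
    using sum.group[OF assms(1-3), of "\<lambda>_. 1 :: nat"] by simp
  have "b * c \<le> card B * c"
    unfolding assms(6)[symmetric] A using sum_bounded_above[of B _ c] fibre by simp
  with \<open>c > 0\<close> \<open>card B \<le> b\<close> show B: "card B = b" by simp
  show "card {x \<in> A. f x = y} = c" if "y \<in> B"
  proof (rule ccontr)
    assume "card {x \<in> A. f x = y} \<noteq> c"
    then have "card {x \<in> A. f x = y} < c" using fibre[OF that] by simp
    then have "card A < (\<Sum>y\<in>B. c)"
      unfolding A using fibre \<open>finite B\<close> that by (intro sum_strict_mono_ex1) auto
    then show False using B assms(6) by simp
  qed
qed

section \<open>Arithmetic in characteristic 2\<close>

text \<open>Translation by 1 permutes the field, so comparing the sums of all elements makes
  \<open>CARD('a)\<close> vanish in it; the characteristic is then a prime dividing a power of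
  2.\<close>

lemma CHAR_eq_2:
  assumes "CARD('a::finite_field) = 2 ^ N"
  shows "CHAR('a) = 2"
proof -
  have "(\<Sum>x\<in>(UNIV::'a set). x) = (\<Sum>x\<in>UNIV. x + 1)"
    by (rule sum.reindex_bij_witness[of _ "\<lambda>x. x + 1" "\<lambda>x. x - 1"]) auto
  then have "of_nat CARD('a) = (0::'a)" by (simp add: sum.distrib)
  then have "CHAR('a) dvd 2 ^ N" unfolding assms of_nat_eq_0_iff_char_dvd .
  then show ?thesis
    using CHAR_prime[where 'a='a] prime_dvd_power primes_dvd_imp_eq two_is_prime_nat by blast
qed

lemma add_self_CHAR_2:
  assumes "CHAR('a::ring_1) = 2"
  shows "x + x = (0::'a)"
  using minus_CHAR_2[OF assms, of x x] by simp

lemma add_self_left_CHAR_2: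
  assumes "CHAR('a::ring_1) = 2"
  shows "x + (x + y) = (y::'a)"
  using add_self_CHAR_2[OF assms, of x] by (simp flip: add.assoc)

lemma of_nat_CHAR_2:
  assumes "CHAR('a::ring_1) = 2"
  shows "of_nat n = (if even n then 0 else 1 :: 'a)"
proof -
  have "(2::'a) = 0" using add_self_CHAR_2[OF assms, of 1] by simp
  then show ?thesis by (auto elim!: evenE oddE)
qed

lemma frobenius_add:
  assumes "CHAR('a::comm_semiring_1) = 2"
  shows "(x + y :: 'a) ^ (2 ^ k) = x ^ (2 ^ k) + y ^ (2 ^ k)"
  by (rule freshmans_dream') (auto simp: assms)

lemma frobenius_sum:
  assumes "CHAR('a::comm_semiring_1) = 2"
  shows "(\<Sum>i\<in>A. f i :: 'a) ^ (2 ^ k) = (\<Sum>i\<in>A. f i ^ (2 ^ k))"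
  by (rule freshmans_dream_sum') (auto simp: assms)

section \<open>Frobenius fixed points and trace fibres\<close>

lemma card_power_fixed_le:
  assumes "r \<ge> 2"
  shows "card {x::'a::field. x ^ r = x} \<le> r"
proof -
  define p :: "'a poly" where "p = monom 1 r - monom 1 1"
  have "coeff p r = 1" using assms by (simp add: p_def)
  then have "p \<noteq> 0" by force
  have "card {x::'a. x ^ r = x} = card {x. poly p x = 0}"
    by (simp add: p_def poly_monom)
  also have "\<dots> \<le> degree p" by (rule card_poly_roots_bound) fact
  also have "\<dots> \<le> r" unfolding p_def using assms
    by (intro degree_diff_le order.trans[OF degree_monom_le]) auto
  finally show ?thesis .
qed

lemma card_Tr_fibre_le:
  assumes "q \<ge> 2" "d \<ge> 1"
  shows "card {x. Tr q d x = t} \<le> q ^ (d - 1)"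
proof -
  define p where "p = (\<Sum>i<d. monom 1 (q ^ i)) - [:t:]"
  \<comment> \<open>The exponents \<open>q ^ i\<close> are distinct and positive, so neither the
    other monomials nor \<open>t\<close> contribute to this coefficient.\<close>
  have "coeff p (q ^ (d - 1)) = (\<Sum>i<d. if i = d - 1 then 1 else 0)"
    using assms by (auto simp: p_def coeff_sum coeff_pCons power_inject_exp split: nat.splits intro!: sum.cong)
  also have "\<dots> = 1" using assms by simp
  finally have "p \<noteq> 0" by force
  have "card {x. Tr q d x = t} = card {x. poly p x = 0}"
    by (simp add: p_def poly_sum poly_monom Tr_def)
  also have "\<dots> \<le> degree p" by (rule card_poly_roots_bound) fact
  also have "\<dots> \<le> q ^ (d - 1)" unfolding p_def using assms
    by (intro degree_diff_le degree_sum_le order.trans[OF degree_monom_le]) auto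
  finally show ?thesis .
qed

text \<open>Raising to the power \<open>q\<close> shifts the summands by one place, so the
  difference telescopes; in characteristic 2 it is also the sum.\<close>

lemma Tr_power_add_Tr:
  fixes x :: "'a::finite_field"
  assumes "CHAR('a) = 2" "q = 2 ^ k"
  shows "Tr q d x ^ q + Tr q d x = x ^ (q ^ d) + x"
proof -
  have "Tr q d x ^ q = (\<Sum>i<d. x ^ q ^ Suc i)"
    unfolding Tr_def assms(2) frobenius_sum[OF assms(1)] by (simp add: power_mult[symmetric] mult.commute)
  then have "Tr q d x ^ q - Tr q d x = x ^ (q ^ d) - x"
    using sum_lessThan_telescope[of "\<lambda>i. x ^ q ^ i" d] by (simp add: Tr_def sum_subtractf)
  then show ?thesis by (simp add: minus_CHAR_2[OF assms(1)])
qed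

lemma Tr_add:
  fixes x :: "'a::finite_field"
  assumes "CHAR('a) = 2" "q = 2 ^ k"
  shows "Tr q d (x + y) = Tr q d x + Tr q d y"
  unfolding Tr_def assms(2) by (simp add: frobenius_add[OF assms(1)] power_mult[symmetric] sum.distrib)

text \<open>\<open>G\<close> plays the role of \<open>GF(q ^ d)\<close>. The trace maps it into the
  at most \<open>q\<close> fixed points, with fibres of at most \<open>q ^ (d - 1)\<close> elements,
  so the pigeonhole count turns both bounds into equalities.\<close>

lemma
  fixes G :: "'a::finite_field set"
  assumes char: "CHAR('a) = 2" and q: "q = 2 ^ k" and "k \<ge> 1" "d \<ge> 1"
    and G: "card G = q ^ d" "\<And>x. x \<in> G \<Longrightarrow> x ^ (q ^ d) = x"
  shows card_power_fixed: "card {x::'a. x ^ q = x} = q"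
    and card_Tr_fibre: "t ^ q = t \<Longrightarrow> card {x \<in> G. Tr q d x = t} = q ^ (d - 1)"
proof -
  have "q \<ge> 2" using q \<open>k \<ge> 1\<close> self_le_power[of 2 k] by simp
  have "Tr q d x ^ q = Tr q d x" if "x \<in> G" for x
    using Tr_power_add_Tr[OF char q, of d x] G(2)[OF that] add_self_CHAR_2[OF char]
    by (metis add_right_cancel)
  then have im: "Tr q d ` G \<subseteq> {x. x ^ q = x}" by auto
  have le: "card {x \<in> G. Tr q d x = t} \<le> q ^ (d - 1)" for t
    by (rule order.trans[OF card_mono card_Tr_fibre_le[where t = t]]) (use \<open>q \<ge> 2\<close> \<open>d \<ge> 1\<close> in auto)
  have cd: "card G = q * q ^ (d - 1)" using G(1) \<open>d \<ge> 1\<close> by (simp flip: power_Suc)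
  note * = card_fibres_eq[OF _ _ im le card_power_fixed_le cd]
  show "card {x::'a. x ^ q = x} = q" using * \<open>q \<ge> 2\<close> by simp
  show "card {x \<in> G. Tr q d x = t} = q ^ (d - 1)" if "t ^ q = t"
    using * \<open>q \<ge> 2\<close> that by simp
qed

section \<open>Subfields as sets of Frobenius fixed points\<close>

text \<open>Multiplication by a nonzero \<open>x\<close> permutes \<open>K - {0}\<close>; comparing
  the products of all its elements gives \<open>x ^ (card K - 1) = 1\<close>.\<close>

lemma subfield_power_card:
  assumes "is_subfield (K :: 'a::finite_field set)" "x \<in> K"
  shows "x ^ card K = x"
proof (cases "x = 0")
  case True
  have "card K \<noteq> 0" using assms(2) by (metis card_eq_0_iff empty_iff finite)
  then show ?thesis using True by (simp add: power_0_left)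
next
  case False
  have "(\<Prod>y\<in>K - {0}. y) = (\<Prod>y\<in>K - {0}. x * y)"
    using assms False unfolding is_subfield_def
    by (intro prod.reindex_bij_witness[of _ "\<lambda>y. x * y" "\<lambda>y. inverse x * y"]) auto
  also have "\<dots> = x ^ (card K - 1) * (\<Prod>y\<in>K - {0}. y)"
    using assms by (simp add: prod.distrib is_subfield_def)
  finally have "x ^ (card K - 1) = 1" by simp
  moreover have "card K = Suc (card K - 1)"
    using assms(2) by (metis Suc_diff_1 card_gt_0_iff empty_iff finite)
  ultimately show ?thesis by (metis mult_1_right power_Suc)
qed

lemma subfield_eq_power_fixed:
  assumes "is_subfield (K :: 'a::finite_field set)"
  shows "K = {x. x ^ card K = x}"
proof (rule card_seteq)
  show "K \<subseteq> {x. x ^ card K = x}" using subfield_power_card[OF assms] by auto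
  have "{0, 1} \<subseteq> K" using assms by (auto simp: is_subfield_def)
  then have "card K \<ge> 2" using card_mono[of K "{0, 1}"] by simp
  then show "card {x::'a. x ^ card K = x} \<le> card K" by (rule card_power_fixed_le)
qed simp

section \<open>The second elementary symmetric function\<close>

text \<open>\<open>St\<close> with an arbitrary sequence in place of the conjugates of one element,
  which allows induction on \<open>n\<close>, index shifts and constant sequences.\<close>

definition esym2 :: "nat \<Rightarrow> (nat \<Rightarrow> 'a::comm_ring_1) \<Rightarrow> 'a" where
  "esym2 n a = (\<Sum>(i, j) \<in> {(i, j). i < j \<and> j < n}. a i * a j)"

lemma esym2_0 [simp]: "esym2 0 a = 0"
  by (simp add: esym2_def)

lemma esym2_Suc [simp]: "esym2 (Suc n) a = esym2 n a + (\<Sum>i<n. a i) * a n"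
proof -
  have "{(i, j). i < j \<and> j < Suc n} = {(i, j). i < j \<and> j < n} \<union> (\<lambda>i. (i, n)) ` {..<n}"
    by (auto simp: less_Suc_eq)
  then have "esym2 (Suc n) a = esym2 n a + (\<Sum>(i, j) \<in> (\<lambda>i. (i, n)) ` {..<n}. a i * a j)"
    unfolding esym2_def by (simp only:) (rule sum.union_disjoint, auto simp: finite_St_index)
  also have "(\<Sum>(i, j) \<in> (\<lambda>i. (i, n)) ` {..<n}. a i * a j) = (\<Sum>i<n. a i) * a n"
    by (subst sum.reindex) (auto simp: inj_on_def sum_distrib_right)
  finally show ?thesis .
qed

lemma St_eq_esym2: "St q n x = esym2 n (\<lambda>i. x ^ (q ^ i))"
  by (simp add: St_def esym2_def)

text \<open>The product of the two sums holds all cross terms and the diagonal ones too; the sum on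
  the left compensates for the latter.\<close>

lemma esym2_add:
  "esym2 n (\<lambda>i. a i + b i) + (\<Sum>i<n. a i * b i)
    = esym2 n a + esym2 n b + (\<Sum>i<n. a i) * (\<Sum>i<n. b i)"
  by (induction n) (simp_all add: algebra_simps sum.distrib)

lemma sum_lessThan_add:
  fixes f :: "nat \<Rightarrow> 'a::comm_monoid_add"
  shows "(\<Sum>i<M + p. f i) = (\<Sum>i<M. f i) + (\<Sum>i<p. f (M + i))"
  by (induction p) (simp_all add: ac_simps)

lemma esym2_split:
  "esym2 (M + p) a = esym2 M a + esym2 p (\<lambda>i. a (M + i)) + (\<Sum>i<M. a i) * (\<Sum>i<p. a (M + i))"
proof (induction p)
  case (Suc p)
  then show ?case by (simp add: sum_lessThan_add algebra_simps)
qed simp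

text \<open>There are \<open>M * (2 * M - 1)\<close> index pairs, a number of the same parity as
  \<open>M\<close>.\<close>

lemma esym2_one_CHAR_2:
  assumes "CHAR('a::comm_ring_1) = 2"
  shows "esym2 (2 * M) (\<lambda>i. 1) = (of_nat M :: 'a)"
  by (induction M) (simp_all add: of_nat_CHAR_2[OF assms] add_self_CHAR_2[OF assms])

lemma esym2_scale: "esym2 n (\<lambda>i. c * a i) = c\<^sup>2 * esym2 n a"
  by (induction n) (simp_all add: algebra_simps power2_eq_square flip: sum_distrib_left)

section \<open>The quadratic form St\<close>

locale quartic_degree =
  fixes q k n m :: nat and K :: "'a::finite_field set"
  assumes k: "k \<ge> 1" and q: "q = 2 ^ k"
    and m: "m \<ge> 1" and n: "n = 4 * m"
    and card_univ: "CARD('a) = q ^ n"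
    and subfield: "is_subfield K" and card_K: "card K = q"
begin

abbreviation Q :: nat where "Q \<equiv> q ^ (2 * m)"

abbreviation L :: "'a set" where "L \<equiv> {x. x ^ Q = x}"

abbreviation tr :: "'a \<Rightarrow> 'a" where "tr \<equiv> Tr q n"

abbreviation trL :: "'a \<Rightarrow> 'a" where "trL \<equiv> Tr q (2 * m)"

abbreviation st :: "'a \<Rightarrow> 'a" where "st \<equiv> St q n"

lemma char: "CHAR('a) = 2"
  using card_univ by (intro CHAR_eq_2[where N = "k * n"]) (simp add: q power_mult)

lemmas self = add_self_CHAR_2[OF char] add_self_left_CHAR_2[OF char]

lemmas diff = minus_CHAR_2[OF char]

lemma add_eq_0: "x + y = 0 \<longleftrightarrow> x = (y::'a)"
  by (metis diff right_minus_eq)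

lemma two: "(2::'a) = 0"
  using self(1)[of 1] by simp

lemma q_ge: "q \<ge> 2"
  using q k self_le_power[of 2 k] by simp

lemma K_iff: "x \<in> K \<longleftrightarrow> x ^ q = x"
  using subfield_eq_power_fixed[OF subfield] card_K by auto

lemma frob_power: "q ^ i = 2 ^ (k * i)"
  by (simp add: q power_mult)

lemma frob_add: "(x + y :: 'a) ^ (q ^ i) = x ^ (q ^ i) + y ^ (q ^ i)"
  unfolding frob_power by (rule frobenius_add[OF char])

lemma frob_add': "(x + y :: 'a) ^ q = x ^ q + y ^ q"
  using frob_add[of x y 1] by simp

lemma K_power: "c \<in> K \<Longrightarrow> c ^ (q ^ i) = c"
  by (induction i) (simp_all add: K_iff power_mult)

lemma K_add: "x \<in> K \<Longrightarrow> y \<in> K \<Longrightarrow> x + y \<in> K"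
  and K_divide: "x \<in> K \<Longrightarrow> y \<in> K \<Longrightarrow> x / y \<in> K"
  and K_0: "0 \<in> K" and K_1: "1 \<in> K"
  using subfield by (auto simp: is_subfield_def divide_inverse)

lemma power_univ: "(x::'a) ^ (q ^ n) = x"
  unfolding card_univ[symmetric] by (rule finite_field_power_card_eq_same)

lemma Q_sq: "Q ^ 2 = q ^ n"
  unfolding n by (simp flip: power_mult)

lemma QQ: "((x::'a) ^ Q) ^ Q = x"
  using power_univ[of x] by (simp only: Q_sq[symmetric] power2_eq_square power_mult)

text \<open>The whole field has \<open>Q ^ 2\<close> elements, so it serves as \<open>G\<close> with
  base \<open>Q\<close> and degree 2.\<close>

lemma card_L: "card L = Q"
  using m k by (intro card_power_fixed[OF char frob_power, of _ 2 UNIV])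
    (simp_all only: Q_sq power_univ card_univ, auto)

lemma card_tr: "t \<in> K \<Longrightarrow> card {x. tr x = t} = q ^ (n - 1)"
  using card_Tr_fibre[OF char q k, of n UNIV t] m n K_iff power_univ card_univ by simp

lemma card_trL: "t \<in> K \<Longrightarrow> card {x \<in> L. trL x = t} = q ^ (2 * m - 1)"
  by (rule card_Tr_fibre[OF char q k _ card_L]) (use m K_iff in auto)

text \<open>The map is the relative trace \<open>Tr Q 2\<close> onto \<open>L\<close>.\<close>

lemma card_coset: "c \<in> L \<Longrightarrow> card {x. x + x ^ Q = c} = Q"
proof -
  assume "c \<in> L"
  moreover have "k * (2 * m) \<ge> 1" using m k by simp
  moreover have "Tr Q 2 x = x + x ^ Q" for x :: 'a
    by (simp add: Tr_def numeral_2_eq_2)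
  ultimately show ?thesis
    using card_Tr_fibre[OF char frob_power, of "2 * m" 2 UNIV c]
    by (simp add: Q_sq power_univ card_univ)
qed

text \<open>Since \<open>x\<close> ranges over the whole field, \<open>trL x\<close> may leave
  \<open>K\<close>; the right-hand side measures by how much.\<close>

lemma trL_power: "trL x ^ q + trL x = x + x ^ Q"
  using Tr_power_add_Tr[OF char q, of "2 * m" x] by (simp add: add.commute)

lemma trL_L: "x \<in> L \<Longrightarrow> trL x \<in> K"
  using trL_power[of x] by (simp add: K_iff self add_eq_0)

lemma tr_add: "tr (x + y) = tr x + tr y"
  by (rule Tr_add[OF char q])

lemma trL_add: "trL (x + y) = trL x + trL y"
  by (rule Tr_add[OF char q])

lemma Tr_scale: "c \<in> K \<Longrightarrow> Tr q d (c * x) = c * Tr q d x"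
  by (simp add: Tr_def power_mult_distrib K_power sum_distrib_left)

lemma St_scale: "c \<in> K \<Longrightarrow> St q d (c * x) = c\<^sup>2 * St q d x"
  by (simp add: St_eq_esym2 power_mult_distrib K_power esym2_scale)

text \<open>Transitivity of the trace through \<open>L\<close>.\<close>

lemma tr_eq_trL: "tr x = trL (x + x ^ Q)"
proof -
  have "tr x = (\<Sum>i<2 * m + 2 * m. x ^ (q ^ i))" unfolding Tr_def n by simp
  also have "\<dots> = trL x + (\<Sum>i<2 * m. x ^ (q ^ (2 * m + i)))"
    unfolding Tr_def by (rule sum_lessThan_add)
  also have "\<dots> = trL x + trL (x ^ Q)"
    by (simp add: Tr_def power_add power_mult)
  finally show ?thesis by (simp add: trL_add)
qed

lemma trL_K: "c \<in> K \<Longrightarrow> trL c = 0"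
  by (simp add: Tr_def K_power two)

lemma tr_L: "x \<in> L \<Longrightarrow> tr x = 0"
  using trL_K[OF K_0] by (simp add: tr_eq_trL self)

lemma K_sub_L: "c \<in> K \<Longrightarrow> c \<in> L"
  by (simp add: K_power)

section \<open>Polarisation and special values of \<open>st\<close>\<close>

lemma st_add: "st (x + y) = st x + st y + tr x * tr y + tr (x * y)"
  using esym2_add[of n "\<lambda>i. x ^ (q ^ i)" "\<lambda>i. y ^ (q ^ i)"]
  by (simp add: St_eq_esym2 frob_add Tr_def power_mult_distrib diff flip: eq_diff_eq)

text \<open>The second half of the conjugates of \<open>x\<close> is the first half of those of
  \<open>x ^ Q\<close>.\<close>

lemma esym2_halves:
  "st x = esym2 (2 * m) (\<lambda>i. x ^ (q ^ i)) + esym2 (2 * m) (\<lambda>i. (x ^ Q) ^ (q ^ i)) + trL x * trL (x ^ Q)"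
proof -
  have "st x = esym2 (2 * m + 2 * m) (\<lambda>i. x ^ (q ^ i))"
    by (simp add: St_eq_esym2 n)
  then show ?thesis
    unfolding esym2_split by (simp add: Tr_def power_add power_mult)
qed

text \<open>The two halves coincide and cancel, leaving the product of their equal sums.\<close>

lemma st_L: "x \<in> L \<Longrightarrow> st x = trL x ^ 2"
  by (simp add: esym2_halves self power2_eq_square)

text \<open>Both \<open>st y\<close> and \<open>tr y\<close> vanish, so only the polar term
  survives.\<close>

lemma st_translate:
  assumes "y \<in> L" "trL y = 0"
  shows "st (x + y) = st x + tr (x * y)"
  using assms by (simp add: st_add st_L tr_L)

text \<open>Here \<open>x ^ Q = x + 1\<close>, so the second half of the conjugates is the first
  half plus 1. The two copies of its \<open>esym2\<close> cancel; \<open>of_nat m\<close> comes from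
  the constant sequence 1.\<close>

lemma st_coset:
  assumes "x + x ^ Q = 1"
  shows "st x = trL x ^ 2 + trL x + of_nat m"
proof -
  have x: "x ^ Q = x + 1" using assms by (metis self(2))
  have "esym2 (2 * m) (\<lambda>i. x ^ q ^ i + 1) = esym2 (2 * m) (\<lambda>i. x ^ q ^ i) + of_nat m + trL x"
    using esym2_add[of "2 * m" "\<lambda>i. x ^ (q ^ i)" "\<lambda>i. 1"]
    by (simp add: esym2_one_CHAR_2[OF char] Tr_def two diff flip: eq_diff_eq)
  moreover have "trL (x + 1) = trL x" using trL_K[OF K_1] by (simp add: trL_add)
  ultimately show ?thesis
    unfolding esym2_halves x frob_add by (simp add: self power2_eq_square add_ac)
qed

text \<open>Frobenius rotates the conjugates cyclically, which leaves a symmetric function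
  unchanged.\<close>

lemma st_in_K: "st x \<in> K"
proof -
  let ?a = "\<lambda>i. x ^ (q ^ i)"
  have sh: "(\<Sum>i<n. ?a (Suc i)) = (\<Sum>i<n. ?a i)"
    using sum_lessThan_telescope[of ?a n] by (simp add: power_univ sum_subtractf)
  \<comment> \<open>The \<open>n + 1\<close> conjugates from \<open>x\<close> to
    \<open>x ^ (q ^ n)\<close> begin and end with \<open>x\<close>; dropping the first or the last
    leaves the same value.\<close>
  have "esym2 (1 + n) ?a = esym2 n (\<lambda>i. ?a (1 + i)) + x * (\<Sum>i<n. ?a (1 + i))"
    by (simp only: esym2_split) (simp add: lessThan_Suc)
  then have "esym2 n (\<lambda>i. ?a (Suc i)) = esym2 n ?a"
    by (simp only: esym2_Suc plus_1_eq_Suc sh power_univ) (simp add: mult.commute)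
  moreover have "st x ^ q = esym2 n (\<lambda>i. ?a (Suc i))"
    unfolding St_def esym2_def q frobenius_sum[OF char]
    by (simp add: case_prod_unfold power_mult_distrib mult.commute flip: power_mult)
  ultimately show ?thesis by (simp add: K_iff St_eq_esym2)
qed

lemma sum_count: "t \<in> K \<Longrightarrow> (\<Sum>s\<in>K. count_Tr_St q n t s) = q ^ (n - 1)"
  using sum.group[of "{x. tr x = t}" K st "\<lambda>_. 1::nat"] st_in_K
  by (simp add: card_tr count_Tr_St_def image_subset_iff)

lemma n_pred: "n - 1 = Suc (n - 2)"
  using m n by simp

section \<open>Equidistribution for nonzero trace\<close>

lemma count_trace_nonzero:
  assumes "t \<in> K" "s \<in> K" "t \<noteq> 0"
  shows "count_Tr_St q n t s = q ^ (n - 2)"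
proof -
  have "count_Tr_St q n t s' = count_Tr_St q n t s" if s': "s' \<in> K" for s'
  proof -
    \<comment> \<open>On trace \<open>t\<close>, translation by \<open>c\<close> changes
      \<open>st\<close> by \<open>tr (c * x) = c * t\<close>, which has to be
      \<open>s' + s\<close>.\<close>
    define c where "c = (s' + s) / t"
    have c: "c \<in> K" using assms s' by (simp add: c_def K_add K_divide)
    have tr: "tr (x + c) = tr x" for x using c by (simp add: tr_add tr_L K_power)
    have st: "st (x + c) = st x + (s' + s)" if "tr x = t" for x
    proof -
      have "tr (c * x) = s' + s" using Tr_scale[OF c] that assms by (simp add: c_def)
      then show ?thesis
        using st_translate[OF K_sub_L[OF c] trL_K[OF c], of x] by (simp add: mult.commute)
    qed
    show ?thesis unfolding count_Tr_St_def
      by (rule bij_betw_same_card[of "\<lambda>x. x + c"], rule bij_betw_byWitness[of _ "\<lambda>x. x + c"])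
        (auto simp: tr st self ac_simps)
  qed
  then have "q * count_Tr_St q n t s = q ^ (n - 1)"
    using sum_count[OF \<open>t \<in> K\<close>] by (simp add: card_K)
  then have "q * count_Tr_St q n t s = q * q ^ (n - 2)" by (simp only: n_pred power_Suc)
  then show ?thesis using q_ge by simp
qed

section \<open>Zeros of \<open>st\<close> on the subspace \<open>W\<close>\<close>

text \<open>
  On \<open>{x. x + x ^ Q = 1}\<close> the value \<open>T = trL x\<close> satisfies \<open>T ^ q = T + 1\<close>, and \<open>st x = 0\<close> means
  \<open>T\<^sup>2 + T = m\<close>. For even \<open>m\<close> this forces \<open>T \<in> {0, 1}\<close>; for odd \<open>m\<close> it makes \<open>T\<close> a primitive cube
  root of unity, for which \<open>T ^ q = T + k\<close>.
\<close>

lemma card_cube_roots: "card {w::'a. w\<^sup>2 + w = 1} = 2"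
proof -
  have "CARD('a) = 2 ^ (2 * (k * 2 * m))"
    by (simp add: card_univ q n mult_ac flip: power_mult)
  \<comment> \<open>The field is a power of \<open>GF(4)\<close> in size and so contains it;
    \<open>w\<^sup>2 + w\<close> is the trace \<open>Tr 2 2\<close> from there to
    \<open>GF(2)\<close>.\<close>
  then have N: "CARD('a) = 4 ^ (k * 2 * m)" by (simp only: power_mult) simp
  have "card {x::'a. x ^ 4 = x} = 4"
    using card_power_fixed[OF char, of 4 2 "k * 2 * m" UNIV] k m N
      finite_field_power_card_eq_same[where 'a='a] by simp
  then have card: "card {x \<in> {x::'a. x ^ 4 = x}. Tr 2 2 x = 1} = 2"
    using card_Tr_fibre[OF char, of 2 1 2 "{x::'a. x ^ 4 = x}" 1] by simp
  have "x ^ 4 = x" if "x\<^sup>2 + x = 1" for x :: 'a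
  proof -
    have x: "x\<^sup>2 = x + 1" using that by (metis self(2) add.commute)
    have "x ^ 4 = (x + 1)\<^sup>2" using x by (metis power_even_eq mult_2 numeral_Bit0)
    also have "\<dots> = x\<^sup>2 + 1\<^sup>2"
      using frobenius_add[OF char, of x 1 1] by (simp only: power_one_right)
    also have "\<dots> = x" by (simp add: x add.assoc two)
    finally show ?thesis .
  qed
  moreover have "Tr 2 2 x = x\<^sup>2 + x" for x :: 'a
    by (simp add: Tr_def numeral_2_eq_2 add.commute)
  ultimately have "{w::'a. w\<^sup>2 + w = 1} = {x \<in> {x::'a. x ^ 4 = x}. Tr 2 2 x = 1}" by auto
  with card show ?thesis by simp
qed

text \<open>Each squaring adds 1, because \<open>w\<^sup>2 = w + 1\<close>.\<close>

lemma cube_root_power: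
  assumes "w\<^sup>2 + w = (1::'a)"
  shows "w ^ (2 ^ i) = w + of_nat i"
proof (induction i)
  case (Suc i)
  have w: "w\<^sup>2 = w + 1" using assms by (metis self(2) add.commute)
  have "w ^ (2 ^ Suc i) = (w + of_nat i)\<^sup>2" by (simp add: power_mult mult.commute[of 2] Suc)
  also have "\<dots> = w\<^sup>2 + (of_nat i)\<^sup>2" using frobenius_add[OF char, of w "of_nat i" 1] by simp
  also have "(of_nat i)\<^sup>2 = (of_nat i :: 'a)" by (simp add: of_nat_CHAR_2[OF char])
  finally show ?case by (simp add: w add_ac)
qed simp

text \<open>The possible values of \<open>trL\<close> on this coset form a translate of
  \<open>K\<close> by \<open>T\<close>, so there are at most \<open>q\<close> of them and the
  pigeonhole count applies to the \<open>Q\<close> elements of the coset.\<close>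

lemma card_trL_coset:
  assumes "T ^ q = T + 1"
  shows "card {x. x + x ^ Q = 1 \<and> trL x = T} = q ^ (2 * m - 1)"
proof -
  let ?B = "{T::'a. T ^ q = T + 1}"
  have "card ?B \<le> q"
  proof -
    have "bij_betw (\<lambda>x. x + T) ?B {x. x ^ q = x}"
      by (rule bij_betw_byWitness[of _ "\<lambda>x. x + T"]) (auto simp: frob_add' assms self add_ac)
    then show ?thesis using card_power_fixed_le[OF q_ge, where 'a='a] bij_betw_same_card by metis
  qed
  have im: "trL ` {x. x + x ^ Q = 1} \<subseteq> ?B"
    using trL_power by (auto, metis self(2) add.commute)
  have fib: "card {x \<in> {x. x + x ^ Q = 1}. trL x = y} \<le> q ^ (2 * m - 1)" for y
    by (rule order.trans[OF card_mono card_Tr_fibre_le[where t = y]]) (use q_ge m in auto)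
  have "card {x::'a. x + x ^ Q = 1} = q * q ^ (2 * m - 1)"
    using card_coset[OF K_sub_L[OF K_1]] m by (simp flip: power_Suc)
  from card_fibres_eq(2)[OF _ _ im fib \<open>card ?B \<le> q\<close> this, of T] q_ge assms
  show ?thesis by simp
qed

lemma card_st_zero_coset1:
  "card {x. x + x ^ Q = 1 \<and> st x = 0} = (if odd (m * k) then 2 * q ^ (2 * m - 1) else 0)"
proof (cases "odd m")
  case False
  have "st x \<noteq> 0" if "x + x ^ Q = 1" for x
  proof
    assume "st x = 0"
    then have "trL x * (trL x + 1) = 0"
      using st_coset[OF that] False
      by (simp add: of_nat_CHAR_2[OF char] power2_eq_square algebra_simps)
    then have "trL x \<in> K" using K_0 K_1 by (auto simp: add_eq_0)
    then show False using trL_power[of x] that by (simp add: K_iff self)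
  qed
  then show ?thesis using False by auto
next
  case m_odd: True
  have st: "st x = 0 \<longleftrightarrow> (trL x)\<^sup>2 + trL x = 1" if "x + x ^ Q = 1" for x
    using st_coset[OF that] m_odd by (simp add: of_nat_CHAR_2[OF char] add_eq_0)
  show ?thesis
  proof (cases "odd k")
    case False
    have "st x \<noteq> 0" if x: "x + x ^ Q = 1" for x
    proof
      assume "st x = 0"
      then have "trL x ^ q = trL x"
        using cube_root_power[of "trL x" k] st[OF x] False by (simp add: q of_nat_CHAR_2[OF char])
      then show False using trL_power[of x] x by (simp add: self)
    qed
    then show ?thesis using False by auto
  next
    case True
    have "{x. x + x ^ Q = 1 \<and> st x = 0} = (\<Union>w\<in>{w. w\<^sup>2 + w = 1}. {x. x + x ^ Q = 1 \<and> trL x = w})"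
      using st by auto
    also have "card \<dots> = (\<Sum>w\<in>{w. w\<^sup>2 + w = 1}. card {x. x + x ^ Q = 1 \<and> trL x = w})"
      by (rule card_UN_disjoint) auto
    \<comment> \<open>As \<open>k\<close> is odd, both roots satisfy \<open>w ^ q = w + 1\<close>,
      so both fibres are nonempty.\<close>
    also have "\<dots> = (\<Sum>w\<in>{w::'a. w\<^sup>2 + w = 1}. q ^ (2 * m - 1))"
      using True cube_root_power[of _ k]
      by (intro sum.cong refl card_trL_coset) (simp add: q of_nat_CHAR_2[OF char])
    also have "\<dots> = 2 * q ^ (2 * m - 1)" by (simp add: card_cube_roots)
    finally show ?thesis using m_odd True by simp
  qed
qed

text \<open>Scaling by \<open>c\<close> commutes with \<open>x + x ^ Q\<close> and multiplies
  \<open>st\<close> by the nonzero \<open>c\<^sup>2\<close>.\<close>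

lemma card_st_zero_coset:
  assumes c: "c \<in> K" "c \<noteq> 0"
  shows "card {x. x + x ^ Q = c \<and> st x = 0} = card {x. x + x ^ Q = 1 \<and> st x = 0}"
proof -
  have cQ: "(c * x) ^ Q = c * x ^ Q" for x using c by (simp add: power_mult_distrib K_power)
  have 1: "x + x ^ Q = 1 \<longleftrightarrow> c * x + (c * x) ^ Q = c" for x
    using c by (simp add: cQ flip: distrib_left)
  have 2: "st x = 0 \<longleftrightarrow> st (c * x) = 0" for x
    using c by (simp add: St_scale)
  have "bij_betw ((*) c) {x. x + x ^ Q = 1 \<and> st x = 0} {x. x + x ^ Q = c \<and> st x = 0}"
  proof (rule bij_betw_byWitness[of _ "\<lambda>x. x / c"])
    show "(*) c ` {x. x + x ^ Q = 1 \<and> st x = 0} \<subseteq> {x. x + x ^ Q = c \<and> st x = 0}"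
      using 1 2 by blast
    have "x / c + (x / c) ^ Q = 1 \<and> st (x / c) = 0" if "x + x ^ Q = c" "st x = 0" for x
    proof -
      have "c * (x / c) = x" using c by simp
      then show ?thesis using 1[of "x / c"] 2[of "x / c"] that by simp
    qed
    then show "(\<lambda>x. x / c) ` {x. x + x ^ Q = c \<and> st x = 0} \<subseteq> {x. x + x ^ Q = 1 \<and> st x = 0}"
      by blast
  qed (use c in auto)
  then show ?thesis by (simp add: bij_betw_same_card)
qed

lemma card_st_zero_L: "card {x \<in> L. st x = 0} = q ^ (2 * m - 1)"
proof -
  have "{x \<in> L. st x = 0} = {x \<in> L. trL x = 0}" by (auto simp: st_L)
  then show ?thesis using card_trL[OF K_0] by simp
qed

definition W :: "'a set" where "W = {x. x + x ^ Q \<in> K}"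

lemma card_W: "card W = q ^ (2 * m + 1)"
proof -
  have "card W = (\<Sum>c\<in>K. card {x. x + x ^ Q = c})"
    using sum.group[of W K "\<lambda>x. x + x ^ Q" "\<lambda>_. 1::nat"]
    by (simp add: W_def image_subset_iff cong: conj_cong) (simp add: conj_commute cong: conj_cong)
  also have "\<dots> = (\<Sum>c\<in>K. Q)" by (intro sum.cong refl card_coset K_sub_L)
  finally show ?thesis by (simp add: card_K)
qed

lemma W_tr: "x \<in> W \<Longrightarrow> tr x = 0"
  by (simp add: W_def tr_eq_trL trL_K)

text \<open>\<open>W\<close> splits by the value of \<open>x + x ^ Q\<close>: 0 gives
  \<open>L\<close>, and the \<open>q - 1\<close> other values contribute equally.\<close>

lemma card_st_zero_W:
  "card {x \<in> W. st x = 0} = q ^ (2 * m - 1) + (q - 1) * card {x. x + x ^ Q = 1 \<and> st x = 0}"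
proof -
  have "{x \<in> W. st x = 0} = (\<Union>c\<in>K. {x. x + x ^ Q = c \<and> st x = 0})"
    by (auto simp: W_def)
  also have "card \<dots> = (\<Sum>c\<in>K. card {x. x + x ^ Q = c \<and> st x = 0})"
    by (rule card_UN_disjoint) auto
  also have "\<dots> = card {x. x + x ^ Q = 0 \<and> st x = 0}
      + (\<Sum>c\<in>K - {0}. card {x. x + x ^ Q = c \<and> st x = 0})"
    using K_0 by (intro sum.remove) auto
  also have "{x. x + x ^ Q = 0 \<and> st x = 0} = {x \<in> L. st x = 0}"
    by (auto simp: add_eq_0)
  also have "(\<Sum>c\<in>K - {0}. card {x. x + x ^ Q = c \<and> st x = 0})
      = (\<Sum>c\<in>K - {0}. card {x. x + x ^ Q = 1 \<and> st x = 0})"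
    by (intro sum.cong refl card_st_zero_coset) auto
  finally show ?thesis unfolding card_st_zero_L using K_0 by (simp add: card_K)
qed

section \<open>Equidistribution off \<open>W\<close> along cosets of \<open>L0\<close>\<close>

abbreviation L0 :: "'a set" where "L0 \<equiv> {y \<in> L. trL y = 0}"

abbreviation H :: "'a set" where "H \<equiv> {x. tr x = 0}"

lemma L_add: "x \<in> L \<Longrightarrow> y \<in> L \<Longrightarrow> x + y \<in> L"
  by (simp add: frob_add)

lemma L_mult: "x \<in> L \<Longrightarrow> y \<in> L \<Longrightarrow> x * y \<in> L"
  by (simp add: power_mult_distrib)

lemma L_power: "x \<in> L \<Longrightarrow> x ^ i \<in> L"
proof -
  assume "x \<in> L"
  have "(x ^ i) ^ Q = (x ^ Q) ^ i" by (simp only: power_mult[symmetric] mult.commute)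
  then show ?thesis using \<open>x \<in> L\<close> by simp
qed

lemma L0_add: "x \<in> L0 \<Longrightarrow> y \<in> L0 \<Longrightarrow> x + y \<in> L0"
  using L_add by (simp add: trL_add)

lemma L0_scale: "c \<in> K \<Longrightarrow> x \<in> L0 \<Longrightarrow> c * x \<in> L0"
  using L_mult[OF K_sub_L] by (simp add: Tr_scale)

lemma tr_in_K: "tr x \<in> K"
  using Tr_power_add_Tr[OF char q, of n x] by (simp add: K_iff power_univ self add_eq_0)

lemma trL_frob: "x \<in> L \<Longrightarrow> trL (x ^ q) = trL x"
proof -
  assume "x \<in> L"
  have "trL (x ^ q) = trL x ^ q"
    unfolding Tr_def q frobenius_sum[OF char] by (simp add: mult.commute flip: power_mult)
  then show ?thesis using trL_L[OF \<open>x \<in> L\<close>] by (simp add: K_iff)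
qed

text \<open>Elements \<open>w ^ q + w\<close> with \<open>w\<close> in \<open>L\<close> lie in
  \<open>L0\<close>. For such \<open>y\<close>, \<open>tr (x * y)\<close> becomes
  \<open>trL ((z + z ^ q) * w ^ q)\<close> with \<open>z = x + x ^ Q\<close>, and the first factor
  is invertible because \<open>z\<close> is not in \<open>K\<close>.\<close>

lemma ex_L0_tr_eq_1:
  assumes "x \<notin> W"
  shows "\<exists>y\<in>L0. tr (x * y) = 1"
proof -
  define z where "z = x + x ^ Q"
  have zL: "z \<in> L" by (simp add: z_def frob_add QQ add.commute)
  have "z \<notin> K" using assms by (simp add: W_def z_def)
  then have z: "z + z ^ q \<noteq> 0" by (metis K_iff add_eq_0)
  have "card {g \<in> L. trL g = 1} \<noteq> 0" using card_trL[OF K_1] q_ge by simp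
  then have "{g \<in> L. trL g = 1} \<noteq> {}" by (metis card.empty)
  then obtain g where g: "g \<in> L" "trL g = 1" by blast
  define h where "h = g / (z + z ^ q)"
  have hL: "h \<in> L" using g(1) L_add[OF zL L_power[OF zL, of q]] by (simp add: h_def power_divide)
  \<comment> \<open>The \<open>q\<close>-th root of \<open>h\<close>, by inverting
    Frobenius.\<close>
  define w where "w = h ^ (q ^ (n - 1))"
  have wL: "w \<in> L" unfolding w_def by (rule L_power[OF hL])
  have "w ^ q = h ^ (q ^ n)"
    using n m by (simp add: w_def flip: power_mult power_Suc2)
  then have w: "w ^ q = h" by (simp add: power_univ)
  define y where "y = w ^ q + w"
  have yL: "y \<in> L" unfolding y_def by (intro L_add L_power wL)
  have "trL y = 0" by (simp add: y_def trL_add trL_frob[OF wL] self)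
  moreover have "tr (x * y) = 1"
  proof -
    have "tr (x * y) = trL (z * y)"
      using yL by (simp add: tr_eq_trL z_def power_mult_distrib distrib_right)
    also have "\<dots> = trL (z * w ^ q) + trL (z * w)" by (simp add: y_def distrib_left trL_add)
    also have "trL (z * w) = trL (z ^ q * w ^ q)"
      using trL_frob[OF L_mult[OF zL wL]] by (simp add: power_mult_distrib)
    also have "trL (z * w ^ q) + trL (z ^ q * w ^ q) = trL ((z + z ^ q) * h)"
      by (simp add: w distrib_right trL_add)
    also have "\<dots> = 1" using z g by (simp add: h_def)
    finally show ?thesis .
  qed
  ultimately show ?thesis using yL by blast
qed

text \<open>On \<open>L0\<close> the map \<open>tr (x * y)\<close> is \<open>K\<close>-linear and
  onto \<open>K\<close>, so its \<open>q\<close> fibres have equal size; the zeros of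
  \<open>st (x + y)\<close> form the fibre over \<open>st x\<close>.\<close>

lemma card_L0_st:
  assumes "x \<notin> W"
  shows "q * card {y \<in> L0. st (x + y) = 0} = card L0"
proof -
  obtain y0 where y0: "y0 \<in> L0" "tr (x * y0) = 1" using ex_L0_tr_eq_1[OF assms] by blast
  have eq: "card {y \<in> L0. tr (x * y) = c} = card {y \<in> L0. st (x + y) = 0}" if "c \<in> K" for c
  proof -
    \<comment> \<open>Translation by \<open>y1\<close> carries the fibre over \<open>c\<close> to
      the fibre over \<open>st x\<close>.\<close>
    define y1 where "y1 = (c + st x) * y0"
    have "y1 \<in> L0" unfolding y1_def by (intro L0_scale K_add that st_in_K y0(1))
    have "tr (x * y1) = c + st x"
      using Tr_scale[OF K_add[OF that st_in_K], of n x "x * y0"] y0(2) by (simp add: y1_def mult_ac)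
    then have tr: "tr (x * (y + y1)) = tr (x * y) + (c + st x)" for y
      by (simp add: distrib_left tr_add)
    have st: "st (x + y) = 0 \<longleftrightarrow> tr (x * y) = st x" if "y \<in> L0" for y
      using st_translate that by (auto simp: add_eq_0)
    show ?thesis
    proof (rule bij_betw_same_card[of "\<lambda>y. y + y1"], rule bij_betw_byWitness[of _ "\<lambda>y. y + y1"])
      show "(\<lambda>y. y + y1) ` {y \<in> L0. tr (x * y) = c} \<subseteq> {y \<in> L0. st (x + y) = 0}"
        using L0_add[OF _ \<open>y1 \<in> L0\<close>] st tr self by (smt (verit, best) image_subsetI mem_Collect_eq)
      show "(\<lambda>y. y + y1) ` {y \<in> L0. st (x + y) = 0} \<subseteq> {y \<in> L0. tr (x * y) = c}"
        using L0_add[OF _ \<open>y1 \<in> L0\<close>] st tr self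
        by (smt (verit, best) add.commute image_subsetI mem_Collect_eq)
    qed (simp_all add: add.assoc self)
  qed
  have "card L0 = (\<Sum>c\<in>K. card {y \<in> L0. tr (x * y) = c})"
    using sum.group[of L0 K "\<lambda>y. tr (x * y)" "\<lambda>_. 1::nat"] tr_in_K by (simp add: image_subset_iff)
  also have "\<dots> = (\<Sum>c\<in>K. card {y \<in> L0. st (x + y) = 0})" by (rule sum.cong[OF refl eq])
  finally show ?thesis by (simp only: sum_constant card_K of_nat_id)
qed

text \<open>Double count of the pairs with \<open>st (x + y) = 0\<close>, \<open>y\<close> in
  \<open>L0\<close> and \<open>x\<close> in \<open>H - W\<close>: each \<open>y\<close> permutes
  \<open>H - W\<close>, and each \<open>x\<close> admits the fraction \<open>1 / q\<close> of
  \<open>L0\<close>.\<close>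

lemma card_st_zero_off_W: "q * card {x \<in> H - W. st x = 0} = card (H - W)"
proof -
  have shift: "card {x \<in> H - W. st (x + y) = 0} = card {x \<in> H - W. st x = 0}" if y: "y \<in> L0" for y
  proof -
    have W: "x + y \<in> W \<longleftrightarrow> x \<in> W" for x
      using y by (simp add: W_def frob_add) (simp add: add_ac two)
    have H: "tr (x + y) = tr x" for x using y by (simp add: tr_add tr_L)
    show ?thesis
      by (rule bij_betw_same_card[of "\<lambda>x. x + y"], rule bij_betw_byWitness[of _ "\<lambda>x. x + y"])
        (auto simp: W H add.assoc self)
  qed
  have "q * (card L0 * card {x \<in> H - W. st x = 0})
      = q * (\<Sum>y\<in>L0. card {x \<in> H - W. st (x + y) = 0})"
    by (simp only: shift sum_constant cong: sum.cong) simp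
  also have "(\<Sum>y\<in>L0. card {x \<in> H - W. st (x + y) = 0})
      = (\<Sum>x\<in>H - W. card {y \<in> L0. st (x + y) = 0})"
    using sum.swap_restrict[of L0 "H - W" "\<lambda>_ _. 1::nat" "\<lambda>y x. st (x + y) = 0"] by simp
  also have "q * \<dots> = (\<Sum>x\<in>H - W. card L0)"
    unfolding sum_distrib_left by (intro sum.cong refl card_L0_st) auto
  finally have "card L0 * (q * card {x \<in> H - W. st x = 0}) = card L0 * card (H - W)"
    by (simp add: mult_ac)
  moreover have "card L0 \<noteq> 0" unfolding card_trL[OF K_0] using q_ge by simp
  ultimately show ?thesis unfolding mult_cancel1 by blast
qed

section \<open>Counts for trace zero\<close>

lemma count_zero_zero:
  "int (count_Tr_St q n (0::'a) 0) = int q ^ (n - 2) - (- 1) ^ (m * k) * (int q - 1) * int q ^ (2 * m - 1)"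
proof -
  let ?X = "int q ^ (2 * m - 1)"
  have sub: "W \<subseteq> H" using W_tr by blast
  have "{x. tr x = 0 \<and> st x = 0} = {x \<in> H - W. st x = 0} \<union> {x \<in> W. st x = 0}"
    using sub by auto
  then have "count_Tr_St q n (0::'a) 0 = card {x \<in> H - W. st x = 0} + card {x \<in> W. st x = 0}"
    unfolding count_Tr_St_def by (simp only:) (rule card_Un_disjoint, auto)
  \<comment> \<open>The factor \<open>q\<close> stays until the end because the count off
    \<open>W\<close> is known only after multiplication by it.\<close>
  then have "int q * int (count_Tr_St q n (0::'a) 0)
      = int (card (H - W)) + int q * int (card {x \<in> W. st x = 0})"
    using card_st_zero_off_W by (simp add: distrib_left flip: of_nat_mult)
  also have "card (H - W) = q ^ (n - 1) - q ^ (2 * m + 1)"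
    using sub by (simp add: card_Diff_subset card_tr[OF K_0] card_W)
  also have "int \<dots> = int q * int q ^ (n - 2) - int q ^ (2 * m + 1)"
  proof -
    \<comment> \<open>The natural subtraction is not truncated, as
      \<open>2 * m + 1 \<le> 4 * m - 1\<close>.\<close>
    have "q ^ (2 * m + 1) \<le> q ^ (n - 1)" using m n q_ge by (intro power_increasing) auto
    then show ?thesis by (simp only: of_nat_diff) (simp only: n_pred power_Suc of_nat_mult of_nat_power)
  qed
  also have "int q ^ (2 * m + 1) = int q * (int q * ?X)"
    using m by (cases m) simp_all
  \<comment> \<open>The factor \<open>1 - (- 1) ^ (m * k)\<close> is 2 for odd \<open>m * k\<close>
    and 0 otherwise, which merges the two cases.\<close>
  also have "int (card {x \<in> W. st x = 0}) = ?X + (int q - 1) * (1 - (- 1) ^ (m * k)) * ?X"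
    using q_ge by (simp add: card_st_zero_W card_st_zero_coset1 of_nat_diff)
  finally have "int q * int (count_Tr_St q n (0::'a) 0)
      = int q * (int q ^ (n - 2) - (- 1) ^ (m * k) * (int q - 1) * ?X)"
    by (simp add: algebra_simps)
  then show ?thesis using q_ge by simp
qed

lemma count_zero_scale:
  assumes "s \<in> K" "s' \<in> K" "s \<noteq> 0" "s' \<noteq> 0"
  shows "count_Tr_St q n 0 s = count_Tr_St q n 0 s'"
proof -
  \<comment> \<open>The square root of \<open>s' / s\<close> in \<open>K\<close>: squaring once more
    gives the power \<open>q\<close>, which fixes \<open>K\<close>.\<close>
  define c where "c = (s' / s) ^ (2 ^ (k - 1))"
  have K: "s' / s \<in> K" using assms by (simp add: K_divide)
  have "2 ^ (k - 1) * 2 = q" using k q by (simp flip: power_Suc2)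
  then have c2: "c\<^sup>2 = s' / s" using K unfolding c_def K_iff by (simp flip: power_mult)
  have c: "c \<in> K" using K unfolding c_def K_iff by (metis mult.commute power_mult)
  have c0: "c \<noteq> 0" using assms by (simp add: c_def)
  have st: "st (c * x) = s' \<longleftrightarrow> st x = s" for x
    using assms by (auto simp: St_scale[OF c] c2 field_simps)
  have tr: "tr (c * x) = 0 \<longleftrightarrow> tr x = 0" for x
    using c0 by (simp add: Tr_scale[OF c])
  show ?thesis unfolding count_Tr_St_def
    by (rule bij_betw_same_card[of "\<lambda>x. c * x"], rule bij_betw_byWitness[of _ "\<lambda>x. x / c"])
      (use c0 st[of "_ / c"] tr[of "_ / c"] in \<open>auto simp: st tr\<close>)
qed

text \<open>The \<open>q - 1\<close> equal counts share what the value 0 leaves of the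
  \<open>q ^ (n - 1)\<close> elements of trace zero.\<close>

lemma count_zero_nonzero:
  assumes "s \<in> K" "s \<noteq> 0"
  shows "int (count_Tr_St q n 0 s) = int q ^ (n - 2) + (- 1) ^ (m * k) * int q ^ (2 * m - 1)"
proof -
  have "q ^ (n - 1) = count_Tr_St q n (0::'a) 0 + (\<Sum>s'\<in>K - {0}. count_Tr_St q n 0 s')"
    unfolding sum_count[OF K_0, symmetric] using K_0 by (intro sum.remove) auto
  also have "(\<Sum>s'\<in>K - {0}. count_Tr_St q n 0 s') = (\<Sum>s'\<in>K - {0}. count_Tr_St q n 0 s)"
    using assms by (intro sum.cong refl count_zero_scale) auto
  also have "\<dots> = (q - 1) * count_Tr_St q n 0 s" using K_0 by (simp add: card_K)
  finally have "int (q ^ (n - 1)) = int (count_Tr_St q n (0::'a) 0) + (int q - 1) * int (count_Tr_St q n 0 s)"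
    using q_ge by (simp add: of_nat_diff)
  moreover have "int (q ^ (n - 1)) = int q * int q ^ (n - 2)"
    by (simp only: n_pred power_Suc of_nat_mult of_nat_power)
  ultimately have "(int q - 1) * int (count_Tr_St q n 0 s)
      = (int q - 1) * (int q ^ (n - 2) + (- 1) ^ (m * k) * int q ^ (2 * m - 1))"
    by (simp add: count_zero_zero algebra_simps)
  then show ?thesis using q_ge by simp
qed

end

theorem theorem4:
  fixes q k n m :: nat
    and K :: "'a::finite_field set"
    and t s :: 'a
  assumes "k \<ge> 1" and "q = 2 ^ k"
    and "m \<ge> 1" and "n = 4 * m"
    and "CARD('a) = q ^ n"
    and "is_subfield K" and "card K = q"
    and "t \<in> K" and "s \<in> K"
  shows "int (count_Tr_St q n t s) =
    (if t = 0 then int q ^ (n - 2) - (- 1) ^ (m * k) * v q s * int q ^ (2 * m - 1)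
     else int q ^ (n - 2))"
proof -
  interpret quartic_degree q k n m K using assms by unfold_locales
  show ?thesis
    using count_trace_nonzero[OF assms(8,9)] count_zero_zero count_zero_nonzero[OF assms(9)]
    by (cases "t = 0"; cases "s = 0") (simp_all add: v_def)
qed

end
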